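(* Let $(S,\{\to_e,\to_{\neg e}\})$ be a full essential system, with $\to\;=\;\to_e\cup\to_{\neg e}$. Then $\to_e$ is a normalizing reduction for $\to$: for every $t\in S$, if $t$ is weakly $\to$-normalizing then $t$ is strongly $\to_e$-normalizing.
   Context: A rewriting system is a pair $(S,\to)$ with $S$ a set and $\to\subseteq S\times S$. We write $(S,\{\to_e,\to_{\neg e}\})$ for the rewriting system $(S,\to)$ with $\to\;=\;\to_e\cup\to_{\neg e}$ ($\to_e$ and $\to_{\neg e}$ need not be disjoint). $\to^*$ is the reflexive-transitive closure, and $t\to_a\cdot\to_b s$ means $t\to_a u\to_b s$ for some $u$. A term $t$ is $\to$-normal if there is no $s$ with $t\to s$; weakly $\to$-normalizing if $t\to^* s$ for some $\to$-normal $s$; strongly $\to$-normalizing if there is no infinite $\to$-sequence from $t$. A reduction $\to_e\subseteq\to$ is full if $\to_e$ and $\to$ have the same normal forms. The system $(S,\{\to_e,\to_{\neg e}\})$ is essential if: (1) Persistence: if $t\to_e s$ and $t\to_{\neg e}u$ then $u\to_e r$ for some $r$; (2) Uniform termination: if $t$ is weakly $\to_e$-normalizing then it is strongly $\to_e$-normalizing; (3) Terminal factorization: if $t\to^* u$ and $u$ is $\to_e$-normal then $t\to_e^*\cdot\to_{\neg e}^* u$. It is full if moreover $\to_e$ is full for $\to$. A full reduction $\to_e$ for $\to$ is normalizing if every weakly $\to$-normalizing term is strongly $\to_e$-normalizing. *)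

theory Defs
  imports Main
begin

definition rewriting_system :: "'a set \<Rightarrow> 'a rel \<Rightarrow> bool" where
  "rewriting_system S r \<longleftrightarrow> r \<subseteq> S \<times> S"

definition normal_term :: "'a rel \<Rightarrow> 'a \<Rightarrow> bool" where
  "normal_term r t \<longleftrightarrow> (\<nexists>s. (t, s) \<in> r)"

definition weakly_normalizing :: "'a rel \<Rightarrow> 'a \<Rightarrow> bool" where
  "weakly_normalizing r t \<longleftrightarrow> (\<exists>s. (t, s) \<in> r\<^sup>* \<and> normal_term r s)"

definition strongly_normalizing :: "'a rel \<Rightarrow> 'a \<Rightarrow> bool" where
  "strongly_normalizing r t \<longleftrightarrow>
    (\<nexists>f :: nat \<Rightarrow> 'a. f 0 = t \<and> (\<forall>i. (f i, f (Suc i)) \<in> r))"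

definition full_reduction :: "'a set \<Rightarrow> 'a rel \<Rightarrow> 'a rel \<Rightarrow> bool" where
  "full_reduction S e r \<longleftrightarrow>
    e \<subseteq> r \<and> (\<forall>t\<in>S. normal_term e t \<longleftrightarrow> normal_term r t)"

definition normalizing_reduction :: "'a set \<Rightarrow> 'a rel \<Rightarrow> 'a rel \<Rightarrow> bool" where
  "normalizing_reduction S e r \<longleftrightarrow>
    full_reduction S e r \<and>
    (\<forall>t\<in>S. weakly_normalizing r t \<longrightarrow> strongly_normalizing e t)"

definition persistence :: "'a set \<Rightarrow> 'a rel \<Rightarrow> 'a rel \<Rightarrow> bool" where
  "persistence S e n \<longleftrightarrow>
    (\<forall>t\<in>S. \<forall>s\<in>S. \<forall>u\<in>S. (t, s) \<in> e \<and> (t, u) \<in> n \<longrightarrow> (\<exists>r\<in>S. (u, r) \<in> e))"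

definition uniform_termination :: "'a set \<Rightarrow> 'a rel \<Rightarrow> bool" where
  "uniform_termination S e \<longleftrightarrow>
    (\<forall>t\<in>S. weakly_normalizing e t \<longrightarrow> strongly_normalizing e t)"

definition terminal_factorization :: "'a set \<Rightarrow> 'a rel \<Rightarrow> 'a rel \<Rightarrow> bool" where
  "terminal_factorization S e n \<longleftrightarrow>
    (\<forall>t\<in>S. \<forall>u\<in>S. (t, u) \<in> (e \<union> n)\<^sup>* \<and> normal_term e u \<longrightarrow> (t, u) \<in> e\<^sup>* O n\<^sup>*)"

definition essential_system :: "'a set \<Rightarrow> 'a rel \<Rightarrow> 'a rel \<Rightarrow> bool" where
  "essential_system S e n \<longleftrightarrow>
    rewriting_system S (e \<union> n) \<and>
    persistence S e n \<and>
    uniform_termination S e \<and>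
    terminal_factorization S e n"

definition full_essential_system :: "'a set \<Rightarrow> 'a rel \<Rightarrow> 'a rel \<Rightarrow> bool" where
  "full_essential_system S e n \<longleftrightarrow>
    essential_system S e n \<and> full_reduction S e (e \<union> n)"

end

theory Submission
  imports Defs
begin

text \<open>Persistence, read contrapositively, says that \<open>e\<close>-normality propagates backwards along
\<open>n\<close>-steps. Factoring a reduction to normal form as \<open>e\<close>-steps followed by \<open>n\<close>-steps, the
midpoint is therefore already \<open>e\<close>-normal, so uniform termination applies.\<close>

lemma persistence_normal_backwards:
  assumes "persistence S e n" and "rewriting_system S (e \<union> n)"
    and "(v, u) \<in> n\<^sup>*" and "normal_term e u"
  shows "normal_term e v"
  using assms(3)
\<comment> \<open>The \<open>n\<close>-steps are added at the front, so normality starts at the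
  fixed endpoint \<open>u\<close> and moves back from \<open>z\<close> to \<open>y\<close>.\<close>
proof (induction rule: converse_rtrancl_induct)
  case base
  show ?case by (fact assms(4))
next
  case (step y z)
  show ?case
    unfolding normal_term_def
  proof
    assume "\<exists>s. (y, s) \<in> e"
    then obtain s where "(y, s) \<in> e" ..
    \<comment> \<open>Persistence quantifies over \<open>S\<close> only; membership is read off the
      two steps leaving \<open>y\<close>.\<close>
    moreover have "y \<in> S" "z \<in> S" "s \<in> S"
      using assms(2) step.hyps(1) \<open>(y, s) \<in> e\<close> by (auto simp: rewriting_system_def)
    ultimately have "\<exists>r. (z, r) \<in> e"
      using assms(1) step.hyps(1) unfolding persistence_def by blast
    with step.IH show False by (simp add: normal_term_def)
  qed
qed

text \<open>Terminal factorization speaks only of endpoints in \<open>S\<close>, so the normal form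
  reached from \<open>t\<close> must be placed there.\<close>

lemma rewriting_system_rtrancl_closed:
  assumes "rewriting_system S r" and "(t, u) \<in> r\<^sup>*" and "t \<in> S"
  shows "u \<in> S"
  using assms(2,3,1) by (induction rule: rtrancl_induct) (auto simp: rewriting_system_def)

theorem theorem1:
  fixes S :: "'a set" and e n :: "'a rel"
  assumes "full_essential_system S e n"
  shows "normalizing_reduction S e (e \<union> n)"
proof -
  have rs: "rewriting_system S (e \<union> n)" and pers: "persistence S e n"
    and ut: "uniform_termination S e" and tf: "terminal_factorization S e n"
    and full: "full_reduction S e (e \<union> n)"
    using assms by (auto simp: full_essential_system_def essential_system_def)
  have "strongly_normalizing e t" if t: "t \<in> S" "weakly_normalizing (e \<union> n) t" for t
  proof -
    obtain u where tu: "(t, u) \<in> (e \<union> n)\<^sup>*" and nu: "normal_term (e \<union> n) u"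
      using t(2) by (auto simp: weakly_normalizing_def)
    have u: "u \<in> S" using rewriting_system_rtrancl_closed[OF rs tu t(1)] .
    \<comment> \<open>Any \<open>e\<close>-step from \<open>u\<close> would also be an
      \<open>e \<union> n\<close>-step; factorization asks for \<open>e\<close>-normality.\<close>
    have eu: "normal_term e u" using nu by (auto simp: normal_term_def)
    obtain v where tv: "(t, v) \<in> e\<^sup>*" and vu: "(v, u) \<in> n\<^sup>*"
      using tf t(1) u tu eu unfolding terminal_factorization_def by blast
    have "normal_term e v"
      by (rule persistence_normal_backwards[OF pers rs vu eu])
    with tv have "weakly_normalizing e t" by (auto simp: weakly_normalizing_def)
    with ut t(1) show ?thesis by (simp add: uniform_termination_def)
  qed
  with full show ?thesis by (simp add: normalizing_reduction_def)
qed

end
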